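(* Let $X$ be a directed simplicial complex and let $R\in\{\mathbb{Z},\mathbb{Q},\mathbb{R}\}$. Then $H_{2n}^{\mathrm{Dir}}(X,R)=\{0\}$ for every $n\ge1$.
   Context: A directed simplicial complex $X$ on a finite vertex set $V$ is a family of tuples $(x_0,\dots,x_n)$, $n\ge 0$, of elements of $V$ such that, for $n\geq 1$, if $(x_0,\dots,x_n)\in X$ then $(x_0,\dots,\widehat{x_i},\dots,x_n)\in X$ for all $i$ ($\widehat{x_i}$ means $x_i$ is omitted). Repetitions of vertices are allowed, and every vertex belongs to at least one simplex. Tuples of length $n+1$ are called $n$-simplices. $C_n(X,R)$ is the free $R$-module with basis the elementary $n$-chains $[x_0,\dots,x_n]$, one for each $n$-simplex; $\partial_n[x_0,\dots,x_n]=\sum_{i=0}^n(-1)^i[x_0,\dots,\widehat{x_i},\dots,x_n]$ for $n>0$, $\partial_0=0$; $Z_n(X,R)=\ker\partial_n$, $B_n(X,R)=\operatorname{Im}\partial_{n+1}$, $H_n(X,R)=Z_n(X,R)/B_n(X,R)$. $Z_n^{\mathrm{Dir}}(X,R)$ is the set of cycles $\sum_i\lambda_ic_i\in Z_n(X,R)$ with each $c_i$ an elementary $n$-chain and each $\lambda_i\ge0$, and $H_n^{\mathrm{Dir}}(X,R)$ is the $R$-submodule of $H_n(X,R)$ generated by the classes of elements of $Z_n^{\mathrm{Dir}}(X,R)$. *)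

theory Defs
  imports
    "HOL-Library.Poly_Mapping"
    "HOL-Algebra.Module"
    "HOL-Algebra.AbelCoset"
    "HOL-Algebra.Algebraic_Closure_Type"
begin

definition omit :: "nat \<Rightarrow> 'v list \<Rightarrow> 'v list" where
  "omit i s = take i s @ drop (Suc i) s"

definition directed_simplicial_complex :: "'v set \<Rightarrow> 'v list set \<Rightarrow> bool" where
  "directed_simplicial_complex V K \<longleftrightarrow>
     finite V \<and>
     (\<forall>s\<in>K. s \<noteq> [] \<and> set s \<subseteq> V) \<and>
     (\<forall>s\<in>K. length s \<ge> 2 \<longrightarrow> (\<forall>i<length s. omit i s \<in> K)) \<and>
     (\<forall>v\<in>V. \<exists>s\<in>K. v \<in> set s)"

definition simplices :: "'v list set \<Rightarrow> nat \<Rightarrow> 'v list set" where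
  "simplices K n = {s \<in> K. length s = n + 1}"


text \<open>Chains with coefficients in a type are finitely supported functions on tuples. The coefficient
  ring is \<^const>\<open>ring_of_type_algebra\<close>, the ring whose carrier is the whole type.\<close>

definition elem_chain :: "'v list \<Rightarrow> 'v list \<Rightarrow>\<^sub>0 'r::linordered_idom" where
  "elem_chain s = Poly_Mapping.single s 1"

definition chain_scale :: "'r::linordered_idom \<Rightarrow> ('v list \<Rightarrow>\<^sub>0 'r) \<Rightarrow> ('v list \<Rightarrow>\<^sub>0 'r)" where
  "chain_scale r c = Poly_Mapping.map ((*) r) c"

text \<open>The multiplicative fields, present only because module records extend ring records, play
  no role in the module structure.\<close>

definition chain_module ::
  "'v list set \<Rightarrow> nat \<Rightarrow> ('r::linordered_idom, 'v list \<Rightarrow>\<^sub>0 'r) module" where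
  "chain_module K n =
     \<lparr>carrier = {c. Poly_Mapping.keys c \<subseteq> simplices K n},
      monoid.mult = undefined, one = undefined,
      ring.zero = 0, add = (+), module.smult = chain_scale\<rparr>"

definition boundary ::
  "nat \<Rightarrow> ('v list \<Rightarrow>\<^sub>0 'r::linordered_idom) \<Rightarrow> ('v list \<Rightarrow>\<^sub>0 'r)" where
  "boundary n c =
     (if n = 0 then 0
      else \<Sum>s\<in>Poly_Mapping.keys c. chain_scale (Poly_Mapping.lookup c s)
             (\<Sum>i\<le>n. chain_scale ((-1) ^ i) (elem_chain (omit i s))))"

definition cycles :: "'v list set \<Rightarrow> nat \<Rightarrow> ('v list \<Rightarrow>\<^sub>0 'r::linordered_idom) set" where
  "cycles K n = {c \<in> carrier (chain_module K n). boundary n c = 0}"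

definition boundaries :: "'v list set \<Rightarrow> nat \<Rightarrow> ('v list \<Rightarrow>\<^sub>0 'r::linordered_idom) set" where
  "boundaries K n = boundary (n + 1) ` carrier (chain_module K (n + 1))"

definition cycle_module ::
  "'v list set \<Rightarrow> nat \<Rightarrow> ('r::linordered_idom, 'v list \<Rightarrow>\<^sub>0 'r) module" where
  "cycle_module K n = (chain_module K n)\<lparr>carrier := cycles K n\<rparr>"


text \<open>In the quotient of \<open>M\<close> by a submodule \<open>N\<close>, all the cosets in the union defining the scalar
  multiplication coincide.\<close>

definition quotient_module :: "('r, 'm) module \<Rightarrow> 'm set \<Rightarrow> ('r, 'm set) module" where
  "quotient_module M N =
     \<lparr>carrier = a_rcosets\<^bsub>M\<^esub> N,
      monoid.mult = undefined, one = undefined,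
      ring.zero = N, add = set_add M,
      module.smult = (\<lambda>r C. \<Union>c\<in>C. N +>\<^bsub>M\<^esub> (r \<odot>\<^bsub>M\<^esub> c))\<rparr>"

definition homology ::
  "'v list set \<Rightarrow> nat \<Rightarrow> ('r::linordered_idom, ('v list \<Rightarrow>\<^sub>0 'r) set) module" where
  "homology K n = quotient_module (cycle_module K n) (boundaries K n)"

definition homology_class ::
  "'v list set \<Rightarrow> nat \<Rightarrow> ('v list \<Rightarrow>\<^sub>0 'r::linordered_idom) \<Rightarrow> ('v list \<Rightarrow>\<^sub>0 'r) set" where
  "homology_class K n z = boundaries K n +>\<^bsub>cycle_module K n\<^esub> z"

definition directed_cycles ::
  "'v list set \<Rightarrow> nat \<Rightarrow> ('v list \<Rightarrow>\<^sub>0 'r::linordered_idom) set" where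
  "directed_cycles K n =
     {z \<in> cycles K n. \<exists>(k::nat) a s.
        (\<forall>i<k. a i \<ge> 0 \<and> s i \<in> simplices K n) \<and>
        z = (\<Sum>i<k. chain_scale (a i) (elem_chain (s i)))}"

definition directed_homology ::
  "'v list set \<Rightarrow> nat \<Rightarrow> ('v list \<Rightarrow>\<^sub>0 'r::linordered_idom) set set" where
  "directed_homology K n =
     (\<lambda>N. submodule N (ring_of_type_algebra :: 'r ring) (homology K n)) hull
       (homology_class K n ` directed_cycles K n)"

end

theory Submission
  imports Defs
begin

text \<open>In positive even degree, \<open>0\<close> is the only directed cycle. Let \<open>\<epsilon>\<close> be the linear map on chains
  that adds up all coefficients. A simplex of dimension \<open>2 * n > 0\<close> has an odd number of faces, whose
  signs \<open>1, -1, \<dots>, 1\<close> add up to \<open>1\<close>, so \<open>\<epsilon> (\<partial> c) = \<epsilon> c\<close> for every chain \<open>c\<close> of that degree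
  (\<open>augmentation_boundary_even\<close>). A cycle \<open>z\<close> of that degree therefore has \<open>\<epsilon> z = 0\<close>, and if its
  coefficients are nonnegative they must all vanish (\<open>directed_cycles_even\<close>).

  Consequently the directed homology is the submodule generated by the class of \<open>0\<close> alone. Being the
  intersection of all submodules that contain this class, it is the zero submodule as soon as
  \<open>{\<zero>}\<close> is a submodule of the homology (\<open>zero_submodule_homology\<close>). This last fact comes
  down to the boundaries being closed under the linear operations, which holds because the
  boundary operator is linear. The argument works over every linearly ordered integral domain.\<close>

text \<open>This is \<open>\<epsilon>\<close>, the augmentation of the chain complex extended to all tuples whatever their
  length, so that it can be applied both to a chain and to its boundary.\<close>
definition augmentation :: "('v list \<Rightarrow>\<^sub>0 'r::linordered_idom) \<Rightarrow> 'r" where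
  "augmentation c = (\<Sum>s\<in>Poly_Mapping.keys c. Poly_Mapping.lookup c s)"

lemma lookup_chain_scale [simp]:
  "Poly_Mapping.lookup (chain_scale r c) s = r * Poly_Mapping.lookup c s"
  by (simp add: chain_scale_def Poly_Mapping.map.rep_eq when_def)

lemma chain_scale_add_left: "chain_scale (a + b) c = chain_scale a c + chain_scale b c"
  by (rule poly_mapping_eqI) (simp add: lookup_add distrib_right)

lemma chain_scale_chain_scale: "chain_scale a (chain_scale b c) = chain_scale (a * b) c"
  by (rule poly_mapping_eqI) (simp add: mult.assoc)

lemma chain_scale_sum: "chain_scale a (sum f A) = (\<Sum>i\<in>A. chain_scale a (f i))"
  by (rule poly_mapping_eqI) (simp add: lookup_sum sum_distrib_left)

lemma chain_scale_zero_left [simp]: "chain_scale 0 c = 0"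
  by (rule poly_mapping_eqI) simp

lemma chain_scale_zero_right [simp]: "chain_scale r 0 = 0"
  by (rule poly_mapping_eqI) simp

lemma keys_chain_scale_subset: "Poly_Mapping.keys (chain_scale r c) \<subseteq> Poly_Mapping.keys c"
  by (auto simp: in_keys_iff)

lemma keys_chain_scale: "r \<noteq> 0 \<Longrightarrow> Poly_Mapping.keys (chain_scale r c) = Poly_Mapping.keys c"
  by (auto simp: in_keys_iff)

lemma augmentation_add: "augmentation (c + d) = augmentation c + augmentation d"
  unfolding augmentation_def by (rule setsum_keys_plus_distrib) auto

lemma augmentation_zero [simp]: "augmentation 0 = 0"
  by (simp add: augmentation_def)

lemma augmentation_sum: "augmentation (sum f A) = (\<Sum>i\<in>A. augmentation (f i))"
  by (induction A rule: infinite_finite_induct) (simp_all add: augmentation_add)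

lemma augmentation_chain_scale: "augmentation (chain_scale r c) = r * augmentation c"
proof (cases "r = 0")
  case False
  then show ?thesis
    by (simp add: augmentation_def keys_chain_scale sum_distrib_left)
qed simp

lemma augmentation_elem_chain [simp]: "augmentation (elem_chain s) = 1"
  by (simp add: augmentation_def elem_chain_def)

lemma sum_alternating_signs_even: "(\<Sum>i\<le>2 * n. (- 1) ^ i) = (1 :: 'r::comm_ring_1)"
  by (induction n) simp_all

text \<open>By linearity it suffices to look at one simplex, where the signs of its \<open>2 * n + 1\<close> faces add
  up to \<open>1\<close>. Degree \<open>0\<close> has to be excluded, because there the boundary is set to \<open>0\<close>.\<close>
lemma augmentation_boundary_even:
  fixes c :: "'v list \<Rightarrow>\<^sub>0 'r::linordered_idom"
  assumes "n \<ge> 1"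
  shows "augmentation (boundary (2 * n) c) = augmentation c"
proof -
  have "augmentation (boundary (2 * n) c) =
      (\<Sum>s\<in>Poly_Mapping.keys c. Poly_Mapping.lookup c s * (\<Sum>i\<le>2 * n. (- 1) ^ i))"
    using assms by (simp add: boundary_def augmentation_sum augmentation_chain_scale)
  also have "\<dots> = augmentation c"
    unfolding sum_alternating_signs_even by (simp add: augmentation_def)
  finally show ?thesis .
qed

lemma eq_zero_if_augmentation_zero:
  assumes "\<And>s. Poly_Mapping.lookup c s \<ge> 0" and "augmentation c = 0"
  shows "c = 0"
proof (rule poly_mapping_eqI)
  fix s
  have "\<forall>t\<in>Poly_Mapping.keys c. Poly_Mapping.lookup c t = 0"
    using assms by (simp add: augmentation_def sum_nonneg_eq_0_iff)
  then show "Poly_Mapping.lookup c s = Poly_Mapping.lookup 0 s"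
    by (auto simp: in_keys_iff)
qed

lemma boundary_zero [simp]: "boundary n 0 = 0"
  by (simp add: boundary_def)

text \<open>The augmentation of a cycle \<open>z\<close> equals that of its boundary, which is \<open>0\<close>. Passing from
  a representation of \<open>z\<close> as a nonnegative combination of elementary chains to the coefficients of
  \<open>z\<close> takes care of simplices that occur several times in the combination.\<close>
lemma directed_cycles_even:
  assumes "n \<ge> 1"
  shows "directed_cycles K (2 * n) = {0 :: 'v list \<Rightarrow>\<^sub>0 'r::linordered_idom}"
proof
  show "directed_cycles K (2 * n) \<subseteq> {0 :: 'v list \<Rightarrow>\<^sub>0 'r}"
  proof
    fix z :: "'v list \<Rightarrow>\<^sub>0 'r"
    assume "z \<in> directed_cycles K (2 * n)"
    then obtain k a s where cycle: "z \<in> cycles K (2 * n)"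
      and nonneg: "\<And>i::nat. i < k \<Longrightarrow> a i \<ge> 0"
      and z: "z = (\<Sum>i<k. chain_scale (a i) (elem_chain (s i)))"
      unfolding directed_cycles_def by blast
    have "Poly_Mapping.lookup z t \<ge> 0" for t
      unfolding z lookup_sum
      by (rule sum_nonneg) (simp add: nonneg elem_chain_def lookup_single when_def)
    moreover have "augmentation z = 0"
      using cycle augmentation_boundary_even[OF assms, of z] by (simp add: cycles_def)
    ultimately show "z \<in> {0}"
      by (simp add: eq_zero_if_augmentation_zero)
  qed
  \<comment> \<open>The zero chain is the empty combination, which is available even if there are no simplices.\<close>
  show "{0 :: 'v list \<Rightarrow>\<^sub>0 'r} \<subseteq> directed_cycles K (2 * n)"
    unfolding directed_cycles_def cycles_def chain_module_def
    by (auto intro!: exI[of _ "0::nat"])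
qed

lemma boundary_add: "boundary n (c + d) = boundary n c + boundary n d"
proof (cases "n = 0")
  case False
  then show ?thesis
    unfolding boundary_def
    by (simp, intro setsum_keys_plus_distrib) (simp_all add: chain_scale_add_left)
qed (simp add: boundary_def)

lemma boundary_chain_scale: "boundary n (chain_scale r c) = chain_scale r (boundary n c)"
proof (cases "r = 0")
  case False
  then show ?thesis
    by (simp add: boundary_def keys_chain_scale chain_scale_sum chain_scale_chain_scale mult.assoc)
qed simp

lemma boundaries_zero: "0 \<in> boundaries K n"
  unfolding boundaries_def by (rule image_eqI[of _ _ 0]) (simp_all add: chain_module_def)

lemma boundaries_add:
  assumes "b \<in> boundaries K n" "b' \<in> boundaries K n"
  shows "b + b' \<in> boundaries K n"
proof -
  from assms obtain c d where "b = boundary (n + 1) c" "b' = boundary (n + 1) d"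
    "Poly_Mapping.keys c \<subseteq> simplices K (n + 1)" "Poly_Mapping.keys d \<subseteq> simplices K (n + 1)"
    by (auto simp: boundaries_def chain_module_def)
  moreover from this have "Poly_Mapping.keys (c + d) \<subseteq> simplices K (n + 1)"
    using keys_add[of c d] by blast
  ultimately show ?thesis
    unfolding boundaries_def
    by (intro image_eqI[of _ _ "c + d"]) (simp_all add: chain_module_def boundary_add)
qed

lemma boundaries_chain_scale:
  assumes "b \<in> boundaries K n"
  shows "chain_scale r b \<in> boundaries K n"
proof -
  from assms obtain c where "b = boundary (n + 1) c" "Poly_Mapping.keys c \<subseteq> simplices K (n + 1)"
    by (auto simp: boundaries_def chain_module_def)
  then show ?thesis
    using keys_chain_scale_subset[of r c] unfolding boundaries_def
    by (intro image_eqI[of _ _ "chain_scale r c"])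
       (auto simp: chain_module_def boundary_chain_scale)
qed

lemma boundaries_uminus:
  assumes "b \<in> boundaries K n"
  shows "- b \<in> boundaries K n"
proof -
  have "- b = chain_scale (- 1) b"
    by (rule poly_mapping_eqI) simp
  then show ?thesis
    using boundaries_chain_scale[OF assms] by metis
qed

lemma boundaries_coset: "boundaries K n +>\<^bsub>cycle_module K n\<^esub> z = (\<lambda>b. b + z) ` boundaries K n"
  by (auto simp: a_r_coset_def' cycle_module_def chain_module_def)

lemma boundaries_translate:
  fixes b :: "'v list \<Rightarrow>\<^sub>0 'r::linordered_idom"
  assumes "b \<in> boundaries K n"
  shows "(\<lambda>c. c + b) ` boundaries K n = boundaries K n"
proof
  show "(\<lambda>c. c + b) ` boundaries K n \<subseteq> boundaries K n"
    using assms by (auto intro: boundaries_add)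
  show "boundaries K n \<subseteq> (\<lambda>c. c + b) ` boundaries K n"
  proof
    fix c :: "'v list \<Rightarrow>\<^sub>0 'r"
    assume "c \<in> boundaries K n"
    then have "c + - b \<in> boundaries K n"
      using assms by (intro boundaries_add boundaries_uminus)
    then show "c \<in> (\<lambda>c. c + b) ` boundaries K n"
      by (intro image_eqI[of _ _ "c + - b"]) simp_all
  qed
qed

lemma homology_zero: "\<zero>\<^bsub>homology K n\<^esub> = boundaries K n"
  by (simp add: homology_def quotient_module_def)

lemma homology_class_zero: "homology_class K n 0 = \<zero>\<^bsub>homology K n\<^esub>"
  by (simp add: homology_class_def boundaries_coset homology_zero)

lemma homology_zero_closed: "\<zero>\<^bsub>homology K n\<^esub> \<in> carrier (homology K n)"
proof -
  have "0 \<in> carrier (cycle_module K n)"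
    by (simp add: cycle_module_def cycles_def chain_module_def)
  then show ?thesis
    unfolding homology_class_zero[symmetric]
    by (auto simp: homology_def quotient_module_def homology_class_def A_RCOSETS_def')
qed

text \<open>Adding a boundary to an element of a coset stays in that coset, since boundaries are closed under
  addition; no element of the coset is missed, because \<open>0\<close> is a boundary.\<close>
lemma homology_zero_add:
  assumes "C \<in> carrier (homology K n)"
  shows "\<zero>\<^bsub>homology K n\<^esub> \<oplus>\<^bsub>homology K n\<^esub> C = C"
proof -
  let ?B = "boundaries K n"
  obtain z where C: "C = (\<lambda>b. b + z) ` ?B"
    using assms by (auto simp: homology_def quotient_module_def A_RCOSETS_def' boundaries_coset)
  have "\<zero>\<^bsub>homology K n\<^esub> \<oplus>\<^bsub>homology K n\<^esub> C = (\<Union>b\<in>?B. \<Union>c\<in>C. {b + c})"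
    by (simp add: homology_def quotient_module_def set_add_def' cycle_module_def chain_module_def)
  also have "\<dots> = C"
  proof
    show "(\<Union>b\<in>?B. \<Union>c\<in>C. {b + c}) \<subseteq> C"
      unfolding C by (auto simp: add.assoc[symmetric] intro!: imageI boundaries_add)
    show "C \<subseteq> (\<Union>b\<in>?B. \<Union>c\<in>C. {b + c})"
      using boundaries_zero by force
  qed
  finally show ?thesis .
qed

lemma homology_smult_zero: "r \<odot>\<^bsub>homology K n\<^esub> \<zero>\<^bsub>homology K n\<^esub> = \<zero>\<^bsub>homology K n\<^esub>"
proof -
  have "r \<odot>\<^bsub>homology K n\<^esub> \<zero>\<^bsub>homology K n\<^esub> =
      (\<Union>b\<in>boundaries K n. (\<lambda>c. c + chain_scale r b) ` boundaries K n)"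
    unfolding homology_def quotient_module_def boundaries_coset
    by (simp add: cycle_module_def chain_module_def)
  also have "\<dots> = boundaries K n"
    using boundaries_zero by (auto simp: boundaries_translate boundaries_chain_scale)
  finally show ?thesis
    by (simp add: homology_zero)
qed

text \<open>The inverse in a quotient is defined by a description operator, so closure under inverses needs
  uniqueness of the inverse of \<open>\<zero>\<close>; this follows from \<open>\<zero>\<close> being neutral.\<close>
lemma zero_submodule_homology: "submodule {\<zero>\<^bsub>homology K n\<^esub>} R (homology K n)"
proof (unfold_locales)
  let ?H = "homology K n"
  have inv: "inv\<^bsub>add_monoid ?H\<^esub> \<zero>\<^bsub>?H\<^esub> = \<zero>\<^bsub>?H\<^esub>"
    unfolding m_inv_def
  proof (rule the_equality)
    show "\<zero>\<^bsub>?H\<^esub> \<in> carrier (add_monoid ?H) \<and>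
      \<zero>\<^bsub>?H\<^esub> \<otimes>\<^bsub>add_monoid ?H\<^esub> \<zero>\<^bsub>?H\<^esub> = \<one>\<^bsub>add_monoid ?H\<^esub> \<and>
      \<zero>\<^bsub>?H\<^esub> \<otimes>\<^bsub>add_monoid ?H\<^esub> \<zero>\<^bsub>?H\<^esub> = \<one>\<^bsub>add_monoid ?H\<^esub>"
      by (simp add: homology_zero_closed homology_zero_add)
  qed (auto simp: homology_zero_add)
  show "inv\<^bsub>add_monoid ?H\<^esub> x \<in> {\<zero>\<^bsub>?H\<^esub>}" if "x \<in> {\<zero>\<^bsub>?H\<^esub>}" for x
    using that inv by simp
qed (auto simp: homology_zero_closed homology_zero_add homology_smult_zero)

theorem directed_homology_even:
  assumes "n \<ge> 1"
  shows "(directed_homology K (2 * n) :: ('v list \<Rightarrow>\<^sub>0 'r::linordered_idom) set set) =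
    {\<zero>\<^bsub>homology K (2 * n)\<^esub>}"
  unfolding directed_homology_def directed_cycles_even[OF assms] image_insert image_empty
    homology_class_zero
  by (intro hull_same zero_submodule_homology)

theorem proposition3p26:
  fixes V :: "'v set" and K :: "'v list set" and n :: nat
  assumes "directed_simplicial_complex V K" and "n \<ge> 1"
  shows "(directed_homology K (2 * n) :: ('v list \<Rightarrow>\<^sub>0 int) set set) = {\<zero>\<^bsub>homology K (2 * n)\<^esub>}
    \<and> (directed_homology K (2 * n) :: ('v list \<Rightarrow>\<^sub>0 rat) set set) = {\<zero>\<^bsub>homology K (2 * n)\<^esub>}
    \<and> (directed_homology K (2 * n) :: ('v list \<Rightarrow>\<^sub>0 real) set set) = {\<zero>\<^bsub>homology K (2 * n)\<^esub>}"
  using assms by (simp add: directed_homology_even)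

end
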